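(* There is an algorithm that, given positive real numbers $\ell_1,\dots,\ell_n$ (the lengths of the $n$ segments of a carpenter's ruler), computes in $O(n^2)$ time the shortest length into which the ruler can be wrapped, i.e. the quantity \[ W(\ell_1,\dots,\ell_n)=\min \max(t_1,\dots,t_m), \] where the minimum ranges over all $m\ge 1$ and all partitions of the sequence $\ell_1,\dots,\ell_n$ into $m$ nonempty consecutive blocks with block sums $t_1,\dots,t_m$ satisfying $t_1\le t_2\le\cdots\le t_{m-1}$ (no constraint is placed on $t_m$).
   Context: A carpenter's ruler consists of $n$ segments of given positive lengths $\ell_1,\dots,\ell_n$ joined end to end by hinges; segments have width $0$ and folds are points. Wrapping the ruler means folding some subset of the hinges by 180 degrees, all in the same rotational direction (all clockwise or all counter-clockwise), so that the ruler lies on a line; the length of the wrapping is the length of the interval it occupies. If the folded hinges split the ruler into consecutive pieces of total lengths $t_1,\dots,t_m$ (from one end to the other), such a same-direction wrapping exists exactly when $t_1\le t_2\le\cdots\le t_{m-1}$ (the last piece may be shorter, in which case it lies inside the previous turn), and its length is then $\max(t_1,\dots,t_m)$. Running times are in a model where arithmetic operations and comparisons on the input numbers take constant time. *)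

theory Defs
  imports Complex_Main "HOL-Library.Landau_Symbols"
begin

section \<open>Wrappings of a ruler\<close>

definition ruler_partitions :: "real list \<Rightarrow> real list list set" where
  "ruler_partitions ls =
     {bs. bs \<noteq> [] \<and> [] \<notin> set bs \<and> concat bs = ls \<and> sorted (butlast (map sum_list bs))}"

definition wrap_length :: "real list list \<Rightarrow> real" where
  "wrap_length bs = Max (set (map sum_list bs))"

definition shortest_wrap :: "real list \<Rightarrow> real" where
  "shortest_wrap ls = Min (wrap_length ` ruler_partitions ls)"

text \<open>The minimum is over a finite nonempty set, so \<^const>\<open>Min\<close> is meaningful.\<close>

lemma length_le_length_concat: "[] \<notin> set bs \<Longrightarrow> length bs \<le> length (concat bs)"
proof (induction bs)
  case (Cons b bs)
  then have "Suc 0 \<le> length b" "length bs \<le> length (concat bs)" by (auto simp: Suc_le_eq)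
  then have "Suc 0 + length bs \<le> length b + length (concat bs)" by (rule add_mono)
  then show ?case by simp
qed simp

lemma length_le_concat: "b \<in> set bs \<Longrightarrow> length b \<le> length (concat bs)"
  by (induction bs) auto

lemma finite_ruler_partitions: "finite (ruler_partitions ls)"
proof -
  let ?B = "{b. set b \<subseteq> set ls \<and> length b \<le> length ls}"
  have "ruler_partitions ls \<subseteq> {bs. set bs \<subseteq> ?B \<and> length bs \<le> length ls}"
  proof
    fix bs assume "bs \<in> ruler_partitions ls"
    then have ls: "ls = concat bs" and ne: "[] \<notin> set bs"
      by (simp_all add: ruler_partitions_def)
    have "b \<in> ?B" if "b \<in> set bs" for b
      using that length_le_concat[OF that] unfolding ls by auto
    then show "bs \<in> {bs. set bs \<subseteq> ?B \<and> length bs \<le> length ls}"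
      using length_le_length_concat[OF ne] unfolding ls by blast
  qed
  moreover have "finite {bs. set bs \<subseteq> ?B \<and> length bs \<le> length ls}"
    by (intro finite_lists_length_le) auto
  ultimately show ?thesis by (rule finite_subset)
qed

lemma ruler_partitions_nonempty: "ls \<noteq> [] \<Longrightarrow> ruler_partitions ls \<noteq> {}"
  by (auto simp: ruler_partitions_def intro!: exI[of _ "[ls]"])

section \<open>Real RAM programs\<close>

text \<open>
  Structured programs for a real RAM. The state has index registers holding natural numbers,
  real registers, and real arrays, all named by numerals occurring in the program text; an array
  cell is addressed by the contents of an index register. Every instruction performs one operation
  and every evaluation of a test performs one comparison; both cost one time unit. There is no
  rounding and no conversion from reals to indices, literals are integers, and indices can only be
  added and subtracted (truncated at zero), so no non-constant amount of work is hidden in a unit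
  step. Division by zero yields zero, as in HOL.
\<close>

record state =
  ireg :: "nat \<Rightarrow> nat"
  rreg :: "nat \<Rightarrow> real"
  arr :: "nat \<Rightarrow> nat \<Rightarrow> real"

datatype instr =
    ILit nat nat
  | IAdd nat nat nat
  | ISub nat nat nat
  | RLit nat int
  | RAdd nat nat nat
  | RSub nat nat nat
  | RMul nat nat nat
  | RDiv nat nat nat
  | Load nat nat nat
  | Store nat nat nat

datatype test =
    ILess nat nat
  | ILe nat nat
  | RLess nat nat
  | RLe nat nat

datatype prog =
    Skip
  | Do instr
  | Seq prog prog
  | Cond test prog prog
  | While test prog

fun exec_instr :: "instr \<Rightarrow> state \<Rightarrow> state" where
  "exec_instr (ILit k c) s = s\<lparr>ireg := (ireg s)(k := c)\<rparr>"
| "exec_instr (IAdd k i j) s = s\<lparr>ireg := (ireg s)(k := ireg s i + ireg s j)\<rparr>"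
| "exec_instr (ISub k i j) s = s\<lparr>ireg := (ireg s)(k := ireg s i - ireg s j)\<rparr>"
| "exec_instr (RLit z c) s = s\<lparr>rreg := (rreg s)(z := of_int c)\<rparr>"
| "exec_instr (RAdd z x y) s = s\<lparr>rreg := (rreg s)(z := rreg s x + rreg s y)\<rparr>"
| "exec_instr (RSub z x y) s = s\<lparr>rreg := (rreg s)(z := rreg s x - rreg s y)\<rparr>"
| "exec_instr (RMul z x y) s = s\<lparr>rreg := (rreg s)(z := rreg s x * rreg s y)\<rparr>"
| "exec_instr (RDiv z x y) s = s\<lparr>rreg := (rreg s)(z := rreg s x / rreg s y)\<rparr>"
| "exec_instr (Load z a i) s = s\<lparr>rreg := (rreg s)(z := arr s a (ireg s i))\<rparr>"
| "exec_instr (Store a i x) s =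
     s\<lparr>arr := (arr s)(a := (arr s a)(ireg s i := rreg s x))\<rparr>"

fun holds :: "test \<Rightarrow> state \<Rightarrow> bool" where
  "holds (ILess i j) s = (ireg s i < ireg s j)"
| "holds (ILe i j) s = (ireg s i \<le> ireg s j)"
| "holds (RLess x y) s = (rreg s x < rreg s y)"
| "holds (RLe x y) s = (rreg s x \<le> rreg s y)"

text \<open>\<open>exec P s t s'\<close>: started in \<open>s\<close>, \<open>P\<close> terminates in \<open>s'\<close> after exactly \<open>t\<close> time units.\<close>

inductive exec :: "prog \<Rightarrow> state \<Rightarrow> nat \<Rightarrow> state \<Rightarrow> bool" where
  Skip: "exec Skip s 1 s"
| Do: "exec (Do c) s 1 (exec_instr c s)"
| Seq: "exec P s t s' \<Longrightarrow> exec Q s' u s'' \<Longrightarrow> exec (Seq P Q) s (t + u) s''"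
| CondTrue: "holds b s \<Longrightarrow> exec P s t s' \<Longrightarrow> exec (Cond b P Q) s (1 + t) s'"
| CondFalse: "\<not> holds b s \<Longrightarrow> exec Q s t s' \<Longrightarrow> exec (Cond b P Q) s (1 + t) s'"
| WhileFalse: "\<not> holds b s \<Longrightarrow> exec (While b P) s 1 s"
| WhileTrue: "holds b s \<Longrightarrow> exec P s t s' \<Longrightarrow> exec (While b P) s' u s'' \<Longrightarrow>
    exec (While b P) s (1 + t + u) s''"

inductive_cases exec_SkipE: "exec Skip s t s'"
inductive_cases exec_DoE: "exec (Do c) s t s'"
inductive_cases exec_SeqE: "exec (Seq P Q) s t s'"
inductive_cases exec_CondE: "exec (Cond b P Q) s t s'"
inductive_cases exec_WhileE: "exec (While b P) s t s'"

lemma exec_deterministic: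
  "exec P s t s' \<Longrightarrow> exec P s u s'' \<Longrightarrow> t = u \<and> s' = s''"
proof (induction arbitrary: u s'' rule: exec.induct)
  case Skip
  then show ?case by (auto elim: exec_SkipE)
next
  case Do
  then show ?case by (auto elim: exec_DoE)
next
  case (Seq P s t s' Q v r)
  from Seq.prems obtain t1 t2 s1 where "exec P s t1 s1" "exec Q s1 t2 s''" "u = t1 + t2"
    by (rule exec_SeqE)
  with Seq.IH show ?case by metis
next
  case (CondTrue b s P t s' Q)
  from CondTrue.prems CondTrue.hyps obtain t1 where "exec P s t1 s''" "u = 1 + t1"
    by (auto elim: exec_CondE)
  with CondTrue.IH show ?case by metis
next
  case (CondFalse b s Q t s' P)
  from CondFalse.prems CondFalse.hyps obtain t1 where "exec Q s t1 s''" "u = 1 + t1"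
    by (auto elim: exec_CondE)
  with CondFalse.IH show ?case by metis
next
  case (WhileFalse b s P)
  from WhileFalse.prems WhileFalse.hyps show ?case by (auto elim: exec_WhileE)
next
  case (WhileTrue b s P t s' v r)
  from WhileTrue.prems WhileTrue.hyps obtain t1 t2 s1
    where "exec P s t1 s1" "exec (While b P) s1 t2 s''" "u = 1 + t1 + t2"
    by (auto elim: exec_WhileE)
  with WhileTrue.IH show ?case by metis
qed

text \<open>
  The input numbers are in array \<open>0\<close> and their count in index register \<open>0\<close>; everything else is
  zero. The result is read from real register \<open>0\<close>.
\<close>

definition input_state :: "real list \<Rightarrow> state" where
  "input_state ls =
     \<lparr>ireg = (\<lambda>_. 0)(0 := length ls),
      rreg = (\<lambda>_. 0),
      arr = (\<lambda>_ _. 0)(0 := (\<lambda>i. if i < length ls then ls ! i else 0))\<rparr>"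

definition result :: "state \<Rightarrow> real" where
  "result s = rreg s 0"

end

theory Submission
  imports Defs
begin

text \<open>
  Call a partition of a prefix of the ruler sorted if all its block sums, including the last, are
  nondecreasing. A sorted partition of the prefix of length \<open>k\<close> extends by the block from \<open>k\<close> to
  \<open>j\<close> exactly when its last sum is at most the sum of that block, so only the least possible last
  sum \<open>F k\<close> matters, and with prefix sums \<open>S\<close> the value \<open>F j\<close> is the minimum of \<open>S j - S k\<close> over
  those \<open>k < j\<close> with \<open>F k \<le> S j - S k\<close>. Since the final block of a wrapping is unconstrained, the
  optimum for the prefix of length \<open>j\<close> is the minimum of \<open>max (F k) (S j - S k)\<close> over \<open>k < j\<close>.
  Both minima are found in one scan over \<open>k\<close>, which gives quadratic time in total.
\<close>

section \<open>Sorted partitions and the recurrences\<close>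

definition sorted_partitions :: "real list \<Rightarrow> real list list set" where
  "sorted_partitions ls = {bs. [] \<notin> set bs \<and> concat bs = ls \<and> sorted (map sum_list bs)}"

text \<open>The value 0 for the empty list lets the first block obey the same rule as later ones: it
  may be appended because its sum is nonnegative.\<close>

definition last_sum :: "real list list \<Rightarrow> real" where
  "last_sum bs = (if bs = [] then 0 else sum_list (last bs))"

definition min_last :: "real list \<Rightarrow> real" where
  "min_last ls = Min (last_sum ` sorted_partitions ls)"

lemma sorted_butlast_real: "sorted xs \<Longrightarrow> sorted (butlast (xs :: real list))"
  by (simp add: butlast_conv_take sorted_wrt_take)

lemma sorted_partitions_Nil: "sorted_partitions [] = {[]}"
proof -
  have "bs = []" if "[] \<notin> set bs" "concat bs = []" for bs :: "real list list"
    using that by (cases bs) auto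
  then show ?thesis by (auto simp: sorted_partitions_def)
qed

lemma finite_sorted_partitions: "finite (sorted_partitions ls)"
proof (cases "ls = []")
  case True
  then show ?thesis by (simp add: sorted_partitions_Nil)
next
  case False
  then have "sorted_partitions ls \<subseteq> ruler_partitions ls"
    by (auto simp: sorted_partitions_def ruler_partitions_def sorted_butlast_real)
  then show ?thesis using finite_ruler_partitions finite_subset by blast
qed

lemma sorted_partitions_nonempty: "sorted_partitions ls \<noteq> {}"
proof (cases "ls = []")
  case False
  then have "[ls] \<in> sorted_partitions ls" by (simp add: sorted_partitions_def)
  then show ?thesis by blast
qed (simp add: sorted_partitions_Nil)

lemma min_last_Nil [simp]: "min_last [] = 0"
  by (simp add: min_last_def sorted_partitions_Nil last_sum_def)

lemma min_last_le: "bs \<in> sorted_partitions ls \<Longrightarrow> min_last ls \<le> last_sum bs"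
  by (simp add: min_last_def finite_sorted_partitions)

lemma min_last_attained: "\<exists>bs \<in> sorted_partitions ls. last_sum bs = min_last ls"
proof -
  have "min_last ls \<in> last_sum ` sorted_partitions ls"
    unfolding min_last_def
    by (intro Min_in) (simp_all add: finite_sorted_partitions sorted_partitions_nonempty)
  then show ?thesis by auto
qed

text \<open>Nondecreasing sums have their maximum at the end, so one comparison decides; for empty
  \<open>bs\<close> it reads \<open>0 \<le> sum_list b\<close>.\<close>

lemma sorted_snoc_last_sum:
  assumes "\<forall>b\<in>set bs. 0 \<le> sum_list b" "0 \<le> sum_list b"
  shows "sorted (map sum_list (bs @ [b])) \<longleftrightarrow>
    sorted (map sum_list bs) \<and> last_sum bs \<le> sum_list b"
proof (cases bs rule: rev_cases)
  case Nil
  then show ?thesis using assms by (simp add: last_sum_def)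
next
  case (snoc cs c)
  then show ?thesis by (fastforce simp: last_sum_def sorted_append)
qed

lemma sum_list_le_last_sum:
  assumes "sorted (map sum_list bs)" "b \<in> set bs"
  shows "sum_list b \<le> last_sum bs"
  using assms
  by (cases bs rule: rev_cases) (auto simp: last_sum_def sorted_append)

lemma wrap_length_snoc:
  assumes "sorted (map sum_list bs)" "0 \<le> sum_list b"
  shows "wrap_length (bs @ [b]) = max (last_sum bs) (sum_list b)"
proof (cases "bs = []")
  case True
  then show ?thesis using assms by (simp add: wrap_length_def last_sum_def)
next
  case False
  then have "Max (sum_list ` set bs) = last_sum bs"
    using assms(1) by (intro Max_eqI) (auto simp: sum_list_le_last_sum, simp add: last_sum_def)
  then show ?thesis using False by (simp add: wrap_length_def max.commute)
qed

text \<open>Dropping the unconstrained last block leaves a sorted partition of a prefix. The cut is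
  at \<open>length (concat bs)\<close>, and \<open>k < length ls\<close> encodes that
  \<open>b\<close> is nonempty.\<close>

lemma snoc_in_ruler_partitions_iff:
  "bs @ [b] \<in> ruler_partitions ls \<longleftrightarrow>
    (\<exists>k<length ls. bs \<in> sorted_partitions (take k ls) \<and> b = drop k ls)" (is "?L \<longleftrightarrow> ?R")
proof
  assume ?L
  then have "concat bs @ b = ls" "b \<noteq> []" "[] \<notin> set bs" "sorted (map sum_list bs)"
    by (auto simp: ruler_partitions_def)
  then show ?R
    by (intro exI[of _ "length (concat bs)"])
      (auto simp: sorted_partitions_def simp del: length_concat)
next
  assume ?R
  then show ?L by (auto simp: ruler_partitions_def sorted_partitions_def)
qed

section \<open>Recurrences from the choice of the last cut\<close>

context
  fixes ls :: "real list"
  assumes pos: "\<forall>x\<in>set ls. 0 < x"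
begin

lemma sum_list_block_nonneg: "set b \<subseteq> set ls \<Longrightarrow> 0 \<le> sum_list b"
  using pos by (intro sum_list_nonneg) (auto intro: less_imp_le)

lemma snoc_in_sorted_partitions_iff:
  "bs @ [b] \<in> sorted_partitions ls \<longleftrightarrow>
    (\<exists>k<length ls. bs \<in> sorted_partitions (take k ls) \<and> b = drop k ls \<and>
      last_sum bs \<le> sum_list b)"
proof -
  have "bs @ [b] \<in> sorted_partitions ls \<longleftrightarrow>
      bs @ [b] \<in> ruler_partitions ls \<and> last_sum bs \<le> sum_list b"
  proof (cases "concat (bs @ [b]) = ls")
    case True
    have "\<forall>c\<in>set (bs @ [b]). 0 \<le> sum_list c"
      using sum_list_block_nonneg True by (metis concat.simps UN_upper set_concat)
    then show ?thesis
      using sorted_snoc_last_sum[of bs b]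
      by (auto simp: sorted_partitions_def ruler_partitions_def)
  qed (simp add: sorted_partitions_def ruler_partitions_def)
  then show ?thesis unfolding snoc_in_ruler_partitions_iff by blast
qed

text \<open>The cut \<open>k\<close> determines the last block, and \<open>max\<close> is monotone
  in \<open>last_sum bs\<close>; hence a least last sum is the best choice for the prefix.\<close>

lemma shortest_wrap_recurrence:
  assumes "ls \<noteq> []"
  shows "shortest_wrap ls =
    Min ((\<lambda>k. max (min_last (take k ls)) (sum_list (drop k ls))) ` {..<length ls})"
    (is "_ = Min (?g ` _)")
proof -
  have nonneg: "0 \<le> sum_list (drop k ls)" for k
    by (rule sum_list_block_nonneg) (rule set_drop_subset)
  have wl: "wrap_length (bs @ [drop k ls]) = max (last_sum bs) (sum_list (drop k ls))"
    if "bs \<in> sorted_partitions (take k ls)" for bs k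
    using that wrap_length_snoc nonneg by (auto simp: sorted_partitions_def)
  let ?m = "Min (?g ` {..<length ls})"
  have "?m \<in> ?g ` {..<length ls}" using assms by (intro Min_in) auto
  then obtain k where k: "k < length ls" "?m = ?g k" by auto
  obtain bs where bs: "bs \<in> sorted_partitions (take k ls)" "last_sum bs = min_last (take k ls)"
    using min_last_attained by blast
  have attained: "?m \<in> wrap_length ` ruler_partitions ls"
    using k bs wl[OF bs(1)] snoc_in_ruler_partitions_iff
    by (intro image_eqI[of _ _ "bs @ [drop k ls]"]) auto
  have least: "?m \<le> wrap_length cs" if cs: "cs \<in> ruler_partitions ls" for cs
  proof (cases cs rule: rev_cases)
    case Nil
    then show ?thesis using cs by (simp add: ruler_partitions_def)
  next
    case (snoc ds b)
    then obtain i where i: "i < length ls" "ds \<in> sorted_partitions (take i ls)" "b = drop i ls"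
      using cs snoc_in_ruler_partitions_iff by blast
    have "?m \<le> ?g i" using i(1) by (intro Min_le) auto
    also have "\<dots> \<le> max (last_sum ds) (sum_list (drop i ls))"
      using min_last_le[OF i(2)] by (intro max.mono) auto
    also have "\<dots> = wrap_length cs" using wl[OF i(2)] snoc i(3) by simp
    finally show ?thesis .
  qed
  show ?thesis
    unfolding shortest_wrap_def using finite_ruler_partitions attained least
    by (intro Min_eqI) auto
qed

text \<open>If some sorted partition of the prefix can precede \<open>drop k ls\<close>, so can one
  with least last sum, and the new last sum depends on \<open>k\<close> alone.\<close>

lemma min_last_recurrence:
  assumes "ls \<noteq> []"
  shows "min_last ls = Min ((\<lambda>k. sum_list (drop k ls)) `
    {k. k < length ls \<and> min_last (take k ls) \<le> sum_list (drop k ls)})" (is "_ = Min (?g ` ?K)")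
proof -
  \<comment> \<open>The cut 0, giving a single block, is always admissible because
    \<open>min_last [] = 0\<close>.\<close>
  have "0 \<in> ?K" using assms sum_list_block_nonneg[of ls] by simp
  then have "Min (?g ` ?K) \<in> ?g ` ?K" by (intro Min_in) auto
  then obtain k where k: "k \<in> ?K" "Min (?g ` ?K) = ?g k" by blast
  obtain bs where bs: "bs \<in> sorted_partitions (take k ls)" "last_sum bs = min_last (take k ls)"
    using min_last_attained by blast
  have "bs @ [drop k ls] \<in> sorted_partitions ls"
    using k bs snoc_in_sorted_partitions_iff by auto
  then have attained: "Min (?g ` ?K) \<in> last_sum ` sorted_partitions ls"
    using k(2) by (intro image_eqI[of _ _ "bs @ [drop k ls]"]) (auto simp: last_sum_def)
  have least: "Min (?g ` ?K) \<le> last_sum cs" if cs: "cs \<in> sorted_partitions ls" for cs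
  proof (cases cs rule: rev_cases)
    case Nil
    then show ?thesis using cs assms by (simp add: sorted_partitions_def)
  next
    case (snoc ds b)
    then obtain i where i: "i < length ls" "ds \<in> sorted_partitions (take i ls)" "b = drop i ls"
        "last_sum ds \<le> sum_list b"
      using cs snoc_in_sorted_partitions_iff by blast
    then have "i \<in> ?K" using min_last_le[OF i(2)] by auto
    then have "Min (?g ` ?K) \<le> ?g i" by (intro Min_le) auto
    then show ?thesis using snoc i(3) by (simp add: last_sum_def)
  qed
  show ?thesis
    unfolding min_last_def[of ls] using finite_sorted_partitions attained least
    by (intro Min_eqI) auto
qed

end

section \<open>Recurrences in terms of prefix sums\<close>

abbreviation prefix_sum :: "real list \<Rightarrow> nat \<Rightarrow> real" where
  "prefix_sum ls j \<equiv> sum_list (take j ls)"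

abbreviation prefix_last :: "real list \<Rightarrow> nat \<Rightarrow> real" where
  "prefix_last ls j \<equiv> min_last (take j ls)"

lemma sum_list_drop_take:
  "k \<le> j \<Longrightarrow> sum_list (drop k (take j ls)) = prefix_sum ls j - prefix_sum ls k"
  for ls :: "real list"
  using arg_cong[OF append_take_drop_id[of k "take j ls"], of sum_list]
  by (simp add: min_absorb1 del: append_take_drop_id)

lemma prefix_sum_mono:
  assumes "\<forall>x\<in>set ls. 0 < x" "k \<le> j"
  shows "prefix_sum ls k \<le> prefix_sum ls j"
proof -
  have "set (drop k (take j ls)) \<subseteq> set ls"
    using set_drop_subset set_take_subset by (rule order_trans)
  from sum_list_block_nonneg[OF assms(1) this] sum_list_drop_take[OF assms(2)] show ?thesis
    by simp
qed

lemma prefix_recurrences: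
  assumes pos: "\<forall>x\<in>set ls. 0 < x" and j: "0 < j" "j \<le> length ls"
  shows "shortest_wrap (take j ls) =
      Min ((\<lambda>k. max (prefix_last ls k) (prefix_sum ls j - prefix_sum ls k)) ` {..<j})"
    and "prefix_last ls j = Min ((\<lambda>k. prefix_sum ls j - prefix_sum ls k) `
      {k. k < j \<and> prefix_last ls k \<le> prefix_sum ls j - prefix_sum ls k})"
proof -
  have pos': "\<forall>x\<in>set (take j ls). 0 < x" using pos by (meson in_set_takeD)
  have ne: "take j ls \<noteq> []" and len: "length (take j ls) = j" using j by auto
  \<comment> \<open>Prefixes of a prefix are prefixes of \<open>ls\<close>, so one table of values
    serves all \<open>j\<close>.\<close>
  have tk: "take k (take j ls) = take k ls" if "k < j" for k using that by (simp add: min_absorb1)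
  show "shortest_wrap (take j ls) =
      Min ((\<lambda>k. max (prefix_last ls k) (prefix_sum ls j - prefix_sum ls k)) ` {..<j})"
    unfolding shortest_wrap_recurrence[OF pos' ne] len
    by (intro arg_cong[where f = Min] image_cong)
      (auto simp: tk sum_list_drop_take simp del: take_take)
  show "prefix_last ls j = Min ((\<lambda>k. prefix_sum ls j - prefix_sum ls k) `
      {k. k < j \<and> prefix_last ls k \<le> prefix_sum ls j - prefix_sum ls k})"
    unfolding min_last_recurrence[OF pos' ne] len
    by (intro arg_cong[where f = Min] image_cong)
      (auto simp: tk sum_list_drop_take simp del: take_take)
qed

section \<open>Total correctness with time bounds\<close>

text \<open>An upper bound in place of the exact cost lets branches of different length share one
  \<open>b\<close>.\<close>

definition runs :: "prog \<Rightarrow> state \<Rightarrow> nat \<Rightarrow> (state \<Rightarrow> bool) \<Rightarrow> bool" where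
  "runs P s b Q \<longleftrightarrow> (\<exists>t s'. exec P s t s' \<and> t \<le> b \<and> Q s')"

definition instrs :: "instr list \<Rightarrow> prog" where
  "instrs cs = foldr (\<lambda>c. Seq (Do c)) cs Skip"

text \<open>The extra unit pays for the closing \<open>Skip\<close>.\<close>

lemma exec_instrs: "exec (instrs cs) s (Suc (length cs)) (fold exec_instr cs s)"
proof (induction cs arbitrary: s)
  case Nil
  then show ?case using exec.Skip by (simp add: instrs_def)
next
  case (Cons c cs)
  from exec.Seq[OF exec.Do[of c s] Cons.IH] show ?case by (simp add: instrs_def)
qed

lemma runs_instrs: "Q (fold exec_instr cs s) \<Longrightarrow> length cs < b \<Longrightarrow> runs (instrs cs) s b Q"
  unfolding runs_def using exec_instrs by (metis Suc_leI)

lemma runs_Skip: "Q s \<Longrightarrow> 0 < b \<Longrightarrow> runs Skip s b Q"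
  using exec.Skip unfolding runs_def by (metis One_nat_def Suc_leI)

lemma runs_Seq:
  assumes "runs P s b R" "\<And>s'. R s' \<Longrightarrow> runs P' s' b' Q" "b + b' \<le> c"
  shows "runs (Seq P P') s c Q"
proof -
  obtain t s' where 1: "exec P s t s'" "t \<le> b" "R s'" using assms(1) by (auto simp: runs_def)
  obtain u s'' where 2: "exec P' s' u s''" "u \<le> b'" "Q s''"
    using assms(2)[OF 1(3)] by (auto simp: runs_def)
  show ?thesis unfolding runs_def using exec.Seq[OF 1(1) 2(1)] 1(2) 2(2,3) assms(3)
    by (intro exI[of _ "t + u"] exI[of _ s'']) auto
qed

lemma runs_Cond:
  assumes "holds c s \<Longrightarrow> runs P s b Q" "\<not> holds c s \<Longrightarrow> runs P' s b Q" "b < b'"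
  shows "runs (Cond c P P') s b' Q"
proof (cases "holds c s")
  case True
  then show ?thesis using assms exec.CondTrue[OF True] unfolding runs_def
    by (metis Suc_eq_plus1_left Suc_leI Suc_le_mono order_trans)
next
  case False
  then show ?thesis using assms exec.CondFalse[OF False] unfolding runs_def
    by (metis Suc_eq_plus1_left Suc_leI Suc_le_mono order_trans)
qed

text \<open>The invariant is indexed by the number of completed rounds. Each round costs one test
  plus at most \<open>b\<close>, and the failing last test costs one more unit.\<close>

lemma runs_While:
  assumes step: "\<And>k s. k < N \<Longrightarrow> I k s \<Longrightarrow> holds c s \<and> runs P s b (I (Suc k))"
    and stop: "\<And>s. I N s \<Longrightarrow> \<not> holds c s"
    and "I 0 s"
  shows "runs (While c P) s (N * Suc b + 1) (I N)"
proof -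
  \<comment> \<open>Generalised to the \<open>N - k\<close> rounds still to run, for induction
    downwards from \<open>N\<close>.\<close>
  have "runs (While c P) s ((N - k) * Suc b + 1) (I N)" if "k \<le> N" "I k s" for k s
    using that
  proof (induction k arbitrary: s rule: inc_induct)
    case base
    then show ?case using exec.WhileFalse[OF stop[OF base]] by (auto simp: runs_def)
  next
    case (step k)
    from assms(1)[OF step.hyps(2) step.prems] obtain t s'
      where 1: "holds c s" "exec P s t s'" "t \<le> b" "I (Suc k) s'" by (auto simp: runs_def)
    from step.IH[OF 1(4)] obtain u s''
      where 2: "exec (While c P) s' u s''" "u \<le> (N - Suc k) * Suc b + 1" "I N s''"
      by (auto simp: runs_def)
    have "N - k = Suc (N - Suc k)" using step.hyps(2) by (simp add: Suc_diff_Suc)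
    then have "(N - k) * Suc b = Suc b + (N - Suc k) * Suc b" by (simp only: mult_Suc)
    then have "1 + t + u \<le> (N - k) * Suc b + 1" using 1(3) 2(2) by linarith
    then show ?case unfolding runs_def using exec.WhileTrue[OF 1(1,2) 2(1)] 2(3) by blast
  qed
  from this[of 0] assms(3) show ?thesis by simp
qed

section \<open>The program\<close>

text \<open>
  Index registers: 1 holds \<open>j\<close>, 2 holds \<open>k\<close>, 3 holds the constant one. Real registers: 0 and 5 hold
  the running minima for the shortest wrap and for \<open>F j\<close>, 1 holds \<open>S j\<close>, 2 stays zero, 3 holds
  \<open>S j - S k\<close> and 4 holds \<open>F k\<close>. Arrays 1 and 2 store \<open>S\<close> and \<open>F\<close>. Register 5 is overwritten
  without a comparison because \<open>S j - S k\<close> decreases in \<open>k\<close>.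
\<close>

definition inner_body :: prog where
  "inner_body =
     Seq (instrs [Load 3 1 2, RSub 3 1 3, Load 4 2 2])
    (Seq (Cond (RLe 4 3)
            (Seq (instrs [RAdd 5 3 2])
                 (Cond (RLess 3 0) (instrs [RAdd 0 3 2]) Skip))
            (Cond (RLess 4 0) (instrs [RAdd 0 4 2]) Skip))
         (instrs [IAdd 2 2 3]))"

definition outer_body :: prog where
  "outer_body =
     Seq (instrs [Load 3 0 1, RAdd 1 1 3, IAdd 1 1 3, Store 1 1 1, ILit 2 0, RAdd 0 1 2, RAdd 5 1 2])
    (Seq (While (ILess 2 1) inner_body)
         (instrs [Store 2 1 5]))"

definition wrap_prog :: prog where
  "wrap_prog = Seq (instrs [ILit 3 1]) (While (ILess 1 0) outer_body)"

section \<open>Loop invariants and running minima\<close>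

definition frame_inv :: "real list \<Rightarrow> nat \<Rightarrow> state \<Rightarrow> bool" where
  "frame_inv ls j s \<longleftrightarrow> ireg s 0 = length ls \<and> ireg s 1 = j \<and> ireg s 3 = 1 \<and>
     rreg s 1 = prefix_sum ls j \<and> rreg s 2 = 0 \<and> (\<forall>i<length ls. arr s 0 i = ls ! i) \<and>
     (\<forall>i\<le>j. arr s 1 i = prefix_sum ls i)"

text \<open>The guard excludes \<open>j = 0\<close>, where \<open>shortest_wrap []\<close> would be
  the \<open>Min\<close> of an empty set.\<close>

definition outer_inv :: "real list \<Rightarrow> nat \<Rightarrow> state \<Rightarrow> bool" where
  "outer_inv ls j s \<longleftrightarrow> frame_inv ls j s \<and> (\<forall>i\<le>j. arr s 2 i = prefix_last ls i) \<and>
     (0 < j \<longrightarrow> rreg s 0 = shortest_wrap (take j ls))"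

text \<open>The inserted \<open>prefix_sum ls j\<close> is the initial register value and keeps the
  set nonempty for \<open>k = 0\<close>; likewise in \<open>last_upto\<close>.\<close>

definition wrap_upto :: "real list \<Rightarrow> nat \<Rightarrow> nat \<Rightarrow> real" where
  "wrap_upto ls j k = Min (insert (prefix_sum ls j)
     ((\<lambda>i. max (prefix_last ls i) (prefix_sum ls j - prefix_sum ls i)) ` {..<k}))"

definition last_upto :: "real list \<Rightarrow> nat \<Rightarrow> nat \<Rightarrow> real" where
  "last_upto ls j k = Min (insert (prefix_sum ls j) ((\<lambda>i. prefix_sum ls j - prefix_sum ls i) `
     {i. i < k \<and> prefix_last ls i \<le> prefix_sum ls j - prefix_sum ls i}))"

definition inner_inv :: "real list \<Rightarrow> nat \<Rightarrow> nat \<Rightarrow> state \<Rightarrow> bool" where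
  "inner_inv ls j k s \<longleftrightarrow> frame_inv ls j s \<and> (\<forall>i<j. arr s 2 i = prefix_last ls i) \<and>
     ireg s 2 = k \<and> rreg s 0 = wrap_upto ls j k \<and> rreg s 5 = last_upto ls j k"

lemma wrap_upto_0 [simp]: "wrap_upto ls j 0 = prefix_sum ls j"
  by (simp add: wrap_upto_def)

lemma last_upto_0 [simp]: "last_upto ls j 0 = prefix_sum ls j"
  by (simp add: last_upto_def)

lemma wrap_upto_Suc:
  "wrap_upto ls j (Suc k) =
    min (max (prefix_last ls k) (prefix_sum ls j - prefix_sum ls k)) (wrap_upto ls j k)"
  by (simp add: wrap_upto_def lessThan_Suc insert_commute[of "prefix_sum ls j"])

text \<open>Differences of prefix sums do not increase with the index, so the newest admissible
  candidate is the minimum.\<close>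

lemma last_upto_Suc:
  assumes pos: "\<forall>x\<in>set ls. 0 < x"
  shows "last_upto ls j (Suc k) =
    (if prefix_last ls k \<le> prefix_sum ls j - prefix_sum ls k
     then prefix_sum ls j - prefix_sum ls k else last_upto ls j k)"
proof (cases "prefix_last ls k \<le> prefix_sum ls j - prefix_sum ls k")
  case True
  have "prefix_sum ls j - prefix_sum ls k \<le> prefix_sum ls j - prefix_sum ls i" if "i \<le> k" for i
    using prefix_sum_mono[OF pos that] by simp
  \<comment> \<open>This compares the candidate with the inserted starting value.\<close>
  moreover have "0 \<le> prefix_sum ls k" using prefix_sum_mono[OF pos, of 0 k] by simp
  ultimately have "last_upto ls j (Suc k) = prefix_sum ls j - prefix_sum ls k"
    unfolding last_upto_def using True by (intro Min_eqI) auto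
  then show ?thesis using True by simp
next
  case False
  then have "{i. i < Suc k \<and> prefix_last ls i \<le> prefix_sum ls j - prefix_sum ls i} =
      {i. i < k \<and> prefix_last ls i \<le> prefix_sum ls j - prefix_sum ls i}"
    by (auto simp: less_Suc_eq)
  then show ?thesis using False by (simp add: last_upto_def)
qed

text \<open>The starting value is itself the candidate of index 0, as
  \<open>prefix_last ls 0 = 0\<close>, so inserting it changes nothing after a full scan.\<close>

lemma upto_full:
  assumes pos: "\<forall>x\<in>set ls. 0 < x" and j: "0 < j" "j \<le> length ls"
  shows "wrap_upto ls j j = shortest_wrap (take j ls)"
    and "last_upto ls j j = prefix_last ls j"
proof -
  have nonneg: "0 \<le> prefix_sum ls j" using prefix_sum_mono[OF pos, of 0 j] by simp
  have "prefix_sum ls j \<in>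
      (\<lambda>i. max (prefix_last ls i) (prefix_sum ls j - prefix_sum ls i)) ` {..<j}"
    using nonneg j by (intro image_eqI[of _ _ 0]) auto
  then show "wrap_upto ls j j = shortest_wrap (take j ls)"
    unfolding prefix_recurrences(1)[OF assms] wrap_upto_def by (simp add: insert_absorb)
  have "prefix_sum ls j \<in> (\<lambda>i. prefix_sum ls j - prefix_sum ls i) `
      {i. i < j \<and> prefix_last ls i \<le> prefix_sum ls j - prefix_sum ls i}"
    using nonneg j by (intro image_eqI[of _ _ 0]) auto
  then show "last_upto ls j j = prefix_last ls j"
    unfolding prefix_recurrences(2)[OF assms] last_upto_def by (simp add: insert_absorb)
qed

section \<open>Correctness and cost of the two loops\<close>

lemma inner_body_correct:
  assumes pos: "\<forall>x\<in>set ls. 0 < x" and k: "k < j" and inv: "inner_inv ls j k s"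
  shows "runs inner_body s 12 (inner_inv ls j (Suc k))"
proof -
  let ?d = "prefix_sum ls j - prefix_sum ls k"
  let ?A = "\<lambda>s. inner_inv ls j k s \<and> rreg s 3 = ?d \<and> rreg s 4 = prefix_last ls k"
  \<comment> \<open>Candidate \<open>k\<close> is already counted in both minima while the index
    register still holds \<open>k\<close>.\<close>
  let ?B = "\<lambda>s. frame_inv ls j s \<and> (\<forall>i<j. arr s 2 i = prefix_last ls i) \<and> ireg s 2 = k \<and>
    rreg s 0 = wrap_upto ls j (Suc k) \<and> rreg s 5 = last_upto ls j (Suc k)"
  have 1: "runs (instrs [Load 3 1 2, RSub 3 1 3, Load 4 2 2]) s 4 ?A"
    using inv k by (intro runs_instrs) (auto simp: inner_inv_def frame_inv_def)
  \<comment> \<open>The first test decides which argument attains the \<open>max\<close> in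
    \<open>wrap_upto_Suc\<close>, so a single comparison with register 0 updates the
    minimum.\<close>
  have 2: "runs (Cond (RLe 4 3)
      (Seq (instrs [RAdd 5 3 2]) (Cond (RLess 3 0) (instrs [RAdd 0 3 2]) Skip))
      (Cond (RLess 4 0) (instrs [RAdd 0 4 2]) Skip)) s 6 ?B" if A: "?A s" for s
  proof (rule runs_Cond[where b = 5])
    assume "holds (RLe 4 3) s"
    then have le: "prefix_last ls k \<le> ?d" using A by simp
    let ?C = "\<lambda>s. frame_inv ls j s \<and> (\<forall>i<j. arr s 2 i = prefix_last ls i) \<and> ireg s 2 = k \<and>
      rreg s 0 = wrap_upto ls j k \<and> rreg s 3 = ?d \<and> rreg s 5 = last_upto ls j (Suc k)"
    show "runs (Seq (instrs [RAdd 5 3 2]) (Cond (RLess 3 0) (instrs [RAdd 0 3 2]) Skip)) s 5 ?B"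
    proof (rule runs_Seq[where R = ?C and b = 2 and b' = 3])
      show "runs (instrs [RAdd 5 3 2]) s 2 ?C"
        using A le
        by (intro runs_instrs) (auto simp: inner_inv_def frame_inv_def last_upto_Suc[OF pos])
    next
      fix s assume "?C s"
      then show "runs (Cond (RLess 3 0) (instrs [RAdd 0 3 2]) Skip) s 3 ?B"
        using le by (intro runs_Cond[where b = 2] runs_instrs runs_Skip)
          (auto simp: frame_inv_def wrap_upto_Suc)
    qed simp
  next
    assume "\<not> holds (RLe 4 3) s"
    then have gt: "\<not> prefix_last ls k \<le> ?d" using A by simp
    show "runs (Cond (RLess 4 0) (instrs [RAdd 0 4 2]) Skip) s 5 ?B"
      using A gt by (intro runs_Cond[where b = 2] runs_instrs runs_Skip)
        (auto simp: inner_inv_def frame_inv_def wrap_upto_Suc last_upto_Suc[OF pos])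
  qed simp
  have 3: "runs (instrs [IAdd 2 2 3]) s 2 (inner_inv ls j (Suc k))" if "?B s" for s
    using that by (intro runs_instrs) (auto simp: inner_inv_def frame_inv_def)
  show ?thesis
    unfolding inner_body_def
    by (rule runs_Seq[OF 1], rule runs_Seq[OF 2 3, where c = 8]) auto
qed

lemma outer_body_correct:
  assumes pos: "\<forall>x\<in>set ls. 0 < x" and j: "j < length ls" and inv: "outer_inv ls j s"
  shows "runs outer_body s (13 * length ls + 11) (outer_inv ls (Suc j))"
proof -
  have S: "prefix_sum ls (Suc j) = prefix_sum ls j + ls ! j"
    using j by (simp add: take_Suc_conv_app_nth)
  \<comment> \<open>The input is read at \<open>j\<close> before the increment and the prefix sum is
    stored at \<open>Suc j\<close> after it; both minima start from that sum.\<close>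
  have 1: "runs (instrs [Load 3 0 1, RAdd 1 1 3, IAdd 1 1 3, Store 1 1 1, ILit 2 0, RAdd 0 1 2,
      RAdd 5 1 2]) s 8 (inner_inv ls (Suc j) 0)"
    using inv j
    by (intro runs_instrs) (auto simp: outer_inv_def inner_inv_def frame_inv_def S le_Suc_eq)
  have 2: "runs (While (ILess 2 1) inner_body) s (Suc j * Suc 12 + 1)
      (inner_inv ls (Suc j) (Suc j))" if "inner_inv ls (Suc j) 0 s" for s
  proof (rule runs_While[where I = "inner_inv ls (Suc j)"])
    fix k s assume *: "k < Suc j" "inner_inv ls (Suc j) k s"
    then show "holds (ILess 2 1) s \<and> runs inner_body s 12 (inner_inv ls (Suc j) (Suc k))"
      using inner_body_correct[OF pos *] by (simp add: inner_inv_def frame_inv_def)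
  qed (use that in \<open>simp_all add: inner_inv_def frame_inv_def\<close>)
  have 3: "runs (instrs [Store 2 1 5]) s 2 (outer_inv ls (Suc j))"
    if "inner_inv ls (Suc j) (Suc j) s" for s
    using that upto_full[OF pos, of "Suc j"] j
    by (intro runs_instrs) (auto simp: outer_inv_def inner_inv_def frame_inv_def)
  \<comment> \<open>A bound uniform in \<open>j\<close>; 8 units of setup, 1 for the failing test
    and 2 for the final store give \<open>13 * length ls + 11\<close>.\<close>
  have le: "Suc j * Suc 12 \<le> 13 * length ls" using j by simp
  show ?thesis
    unfolding outer_body_def
    by (rule runs_Seq[OF 1], rule runs_Seq[OF 2 3, where c = "13 * length ls + 3"]) (use le in auto)
qed

lemma wrap_prog_correct:
  assumes "ls \<noteq> []" and pos: "\<forall>x\<in>set ls. 0 < x"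
  shows "runs wrap_prog (input_state ls) (length ls * Suc (13 * length ls + 11) + 3)
    (\<lambda>s. result s = shortest_wrap ls)"
proof -
  let ?n = "length ls"
  \<comment> \<open>The zero-initialised arrays already hold the entries of both tables for the
    empty prefix.\<close>
  have 1: "runs (instrs [ILit 3 1]) (input_state ls) 2 (outer_inv ls 0)"
    by (intro runs_instrs) (auto simp: outer_inv_def frame_inv_def input_state_def)
  have 2: "runs (While (ILess 1 0) outer_body) s (?n * Suc (13 * ?n + 11) + 1) (outer_inv ls ?n)"
    if "outer_inv ls 0 s" for s
  proof (rule runs_While)
    fix j s assume *: "j < ?n" "outer_inv ls j s"
    then show "holds (ILess 1 0) s \<and> runs outer_body s (13 * ?n + 11) (outer_inv ls (Suc j))"
      using outer_body_correct[OF pos *] by (simp add: outer_inv_def frame_inv_def)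
  qed (use that in \<open>simp_all add: outer_inv_def frame_inv_def\<close>)
  have "runs wrap_prog (input_state ls) (?n * Suc (13 * ?n + 11) + 3) (outer_inv ls ?n)"
    unfolding wrap_prog_def by (rule runs_Seq[OF 1 2]) auto
  moreover have "result s = shortest_wrap ls" if "outer_inv ls ?n s" for s
    using that assms(1) by (simp add: outer_inv_def result_def)
  ultimately show ?thesis unfolding runs_def by blast
qed

theorem theorem1:
  shows "\<exists>(P :: prog) (T :: nat \<Rightarrow> nat).
    (\<lambda>n. real (T n)) \<in> O(\<lambda>n. (real n)\<^sup>2) \<and>
    (\<forall>ls :: real list. ls \<noteq> [] \<and> (\<forall>x\<in>set ls. 0 < x) \<longrightarrow>
       (\<exists>t s. exec P (input_state ls) t s \<and> t \<le> T (length ls) \<and> result s = shortest_wrap ls))"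
proof (intro exI[of _ wrap_prog] exI[of _ "\<lambda>n. n * Suc (13 * n + 11) + 3"] conjI allI impI)
  show "(\<lambda>n. real (n * Suc (13 * n + 11) + 3)) \<in> O(\<lambda>n. (real n)\<^sup>2)"
  \<comment> \<open>The constant is 13 + 12 + 3, since \<open>n\<close> and 1 are at most
    \<open>n * n\<close> for \<open>n \<ge> 1\<close>.\<close>
  proof (rule bigoI[where c = 28])
    have "real (n * Suc (13 * n + 11) + 3) \<le> 28 * (real n)\<^sup>2" if "1 \<le> n" for n
    proof -
      have "n \<le> n * n" using that by simp
      moreover have "n * Suc (13 * n + 11) = 13 * (n * n) + 12 * n" by (simp add: algebra_simps)
      ultimately have "n * Suc (13 * n + 11) + 3 \<le> 28 * (n * n)" using that by linarith
      then have "real (n * Suc (13 * n + 11) + 3) \<le> real (28 * (n * n))" by (rule of_nat_mono)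
      then show ?thesis by (simp add: power2_eq_square)
    qed
    then show "\<forall>\<^sub>F n in at_top. norm (real (n * Suc (13 * n + 11) + 3)) \<le> 28 * norm ((real n)\<^sup>2)"
      unfolding eventually_sequentially by (intro exI[of _ 1]) (simp del: of_nat_add of_nat_mult)
  qed
next
  fix ls :: "real list" assume "ls \<noteq> [] \<and> (\<forall>x\<in>set ls. 0 < x)"
  then show "\<exists>t s. exec wrap_prog (input_state ls) t s \<and>
      t \<le> length ls * Suc (13 * length ls + 11) + 3 \<and> result s = shortest_wrap ls"
    using wrap_prog_correct unfolding runs_def by blast
qed

end
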